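(* For all integers $n\ge x\ge0$, $$\sum_{k=0}^{n}S(x,k)=B_x,\qquad \sum_{k=0}^{x}\sum_{l=0}^{n}\binom xk S(k,l)=\sum_{k=0}^{x}\binom xk B_k=B_{x+1}.$$
   Context: $S(x,k)$ is the Stirling number of the second kind, the number of partitions of an $x$-element set into exactly $k$ nonempty blocks ($S(0,0)=1$), and $B_x=\sum_{k=0}^{x}S(x,k)$ is the Bell number, with $B_0=1$. (The two left-hand sides are, for $|N|=n$ and $|X|=x$, the numbers of $S_N$-orbits of functions $X\to N$ and of families $(F_i)_{i\in N}$ of pairwise disjoint subsets of $X$.) *)

theory Defs
  imports Complex_Main "HOL-Combinatorics.Stirling" "HOL-Library.Disjoint_Sets"
begin

definition Bell :: "nat \<Rightarrow> nat" where
  "Bell x = (\<Sum>k=0..x. Stirling x k)"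

text \<open>The library introduces \<open>Stirling\<close> by its recurrence. The final theorem of this theory
  shows that it counts the partitions of a finite set into a given number of nonempty blocks.\<close>

lemma partition_on_insert_point_cases:
  assumes a: "a \<notin> A" and Q: "partition_on (insert a A) Q"
  obtains P where "partition_on A P" "Q = insert {a} P" "{a} \<notin> P"
  | P B where "partition_on A P" "B \<in> P" "Q = insert (insert a B) (P - {B})"
proof -
  obtain C where C: "C \<in> Q" "a \<in> C"
    using partition_onD1[OF Q] by auto
  have other: "a \<notin> D \<and> D \<inter> C = {}" if "D \<in> Q" "D \<noteq> C" for D
    using partition_onD2[OF Q] C that by (auto simp: pairwise_def disjnt_def)
  have "disjnt C (\<Union>(Q - {C}))"
    using other by (auto simp: disjnt_def)
  then have QC: "partition_on (insert a A - C) (Q - {C}) \<and> C \<subseteq> insert a A"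
    using partition_on_insert[of C "Q - {C}" "insert a A"] Q C by (simp add: insert_absorb)
  show thesis
  proof (cases "C = {a}")
    case True
    then have "insert a A - C = A" using a by auto
    then show thesis using that(1)[of "Q - {C}"] QC C True by auto
  next
    case False
    define B where "B = C - {a}"
    have B: "B \<noteq> {}" "insert a B = C" "B \<subseteq> A" "A - B = insert a A - C" "B \<notin> Q"
      using False C QC a other[of B] partition_onD3[OF Q] by (auto simp: B_def)
    have dj: "disjnt B (\<Union>(Q - {C}))"
      using other by (auto simp: B_def disjnt_def)
    have "partition_on A (insert B (Q - {C}))"
      using partition_on_insert[OF dj, of A] QC B by simp
    moreover have "Q = insert (insert a B) (insert B (Q - {C}) - {B})"
      using B C by auto
    ultimately show thesis using that(2)[of "insert B (Q - {C})" B] by blast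
  qed
qed

lemma partition_on_add_singleton:
  assumes "a \<notin> A" "partition_on A P"
  shows "partition_on (insert a A) (insert {a} P)"
  using assms by (auto simp: partition_on_def pairwise_def disjnt_def)

lemma partition_on_extend_block:
  assumes "a \<notin> A" "partition_on A P" "B \<in> P"
  shows "partition_on (insert a A) (insert (insert a B) (P - {B}))"
proof -
  have disj: "D \<inter> E = {}" if "D \<in> P" "E \<in> P" "D \<noteq> E" for D E
    using partition_onD2[OF assms(2)] that by (auto simp: pairwise_def disjnt_def)
  have aP: "a \<notin> D" if "D \<in> P" for D
    using partition_onD1[OF assms(2)] assms(1) that by auto
  show ?thesis
  proof (rule partition_onI)
    show "\<Union> (insert (insert a B) (P - {B})) = insert a A"
      using partition_onD1[OF assms(2)] assms(3) by auto
    show "{} \<notin> insert (insert a B) (P - {B})"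
      using partition_onD3[OF assms(2)] by auto
    show "disjnt p q" if "p \<in> insert (insert a B) (P - {B})"
      "q \<in> insert (insert a B) (P - {B})" "p \<noteq> q" for p q
    proof -
      have "p = insert a B \<or> p \<in> P \<and> p \<inter> B = {} \<and> a \<notin> p"
        "q = insert a B \<or> q \<in> P \<and> q \<inter> B = {} \<and> a \<notin> q"
        using that(1,2) disj[OF _ assms(3)] aP by auto
      then show ?thesis
        using that(3) disj[of p q] by (auto simp: disjnt_def)
    qed
  qed
qed

theorem card_partitions_eq_Stirling:
  assumes "finite A"
  shows "card {P. partition_on A P \<and> card P = k} = Stirling (card A) k"
  using assms
proof (induction A arbitrary: k rule: finite_induct)
  case empty
  have eq: "{P. partition_on {} P \<and> card P = k} = (if k = 0 then {{}} else {})"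
    by (auto simp: partition_on_empty)
  show ?case unfolding eq by (cases k) simp_all
next
  case (insert a A)
  let ?Part = "\<lambda>A k. {P. partition_on A P \<and> card P = k}"
  let ?f = "\<lambda>(P, B). insert (insert a B) (P - {B})"
  note fin = finite_elements[OF insert.hyps(1)]
  have aP: "a \<notin> D" if "partition_on A P" "D \<in> P" for P D
    using partition_onD1[OF that(1)] that(2) insert.hyps(2) by auto
  have finPart: "finite (?Part A m)" for m
    by (rule finite_subset[OF _ finitely_many_partition_on[OF insert.hyps(1)]]) auto
  have cardf: "card (?f (P, B)) = card P" if "partition_on A P" "B \<in> P" for P B
  proof -
    have "insert a B \<notin> P - {B}" using aP[OF that(1)] by auto
    then show ?thesis
      using fin[OF that(1)] card.remove[OF _ that(2)] by simp
  qed
  have cards: "card (insert {a} P) = Suc (card P)" if "partition_on A P" for P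
  proof -
    have "{a} \<notin> P" using aP[OF that] by auto
    then show ?thesis using fin[OF that] by simp
  qed
  show ?case
  proof (cases k)
    case 0
    have "?Part (insert a A) 0 = {}"
    proof -
      have "card Q \<noteq> 0" if "partition_on (insert a A) Q" for Q
      proof -
        have "finite Q" using finite_elements[OF _ that] insert.hyps(1) by simp
        moreover have "Q \<noteq> {}" using partition_onD1[OF that] by auto
        ultimately show ?thesis by simp
      qed
      then show ?thesis by blast
    qed
    then have "card (?Part (insert a A) 0) = 0" by (simp only: card.empty)
    then show ?thesis using 0 insert.hyps by simp
  next
    case (Suc j)
    let ?S = "SIGMA P:?Part A (Suc j). P"
    have split: "?Part (insert a A) (Suc j) = insert {a} ` ?Part A j \<union> ?f ` ?S"
    proof (intro equalityI subsetI)
      fix Q assume "Q \<in> ?Part (insert a A) (Suc j)"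
      then have Q: "partition_on (insert a A) Q" "card Q = Suc j" by auto
      show "Q \<in> insert {a} ` ?Part A j \<union> ?f ` ?S"
      proof (rule partition_on_insert_point_cases[OF insert.hyps(2) Q(1)])
        fix P assume P: "partition_on A P" "Q = insert {a} P" "{a} \<notin> P"
        then have "card P = j" using cards Q(2) by auto
        then show ?thesis using P by auto
      next
        fix P B assume P: "partition_on A P" "B \<in> P" "Q = insert (insert a B) (P - {B})"
        then have "card P = Suc j" using cardf[OF P(1,2)] Q(2) by simp
        then have "(P, B) \<in> ?S" using P by auto
        then show ?thesis using P(3) by force
      qed
    next
      fix Q assume "Q \<in> insert {a} ` ?Part A j \<union> ?f ` ?S"
      then show "Q \<in> ?Part (insert a A) (Suc j)"
      proof
        assume "Q \<in> insert {a} ` ?Part A j"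
        then show ?thesis
          using cards partition_on_add_singleton[OF insert.hyps(2)] by auto
      next
        assume "Q \<in> ?f ` ?S"
        then obtain P B where P: "partition_on A P" "card P = Suc j" "B \<in> P" "Q = ?f (P, B)"
          by auto
        then show ?thesis
          using cardf[OF P(1,3)] partition_on_extend_block[OF insert.hyps(2) P(1,3)] by auto
      qed
    qed
    have inj1: "inj_on (insert {a}) (?Part A j)"
    proof (rule inj_onI)
      fix P P' assume "P \<in> ?Part A j" "P' \<in> ?Part A j" "insert {a} P = insert {a} P'"
      moreover from this have "{a} \<notin> P" "{a} \<notin> P'" using aP by blast+
      ultimately show "P = P'" by (simp add: insert_ident)
    qed
    have recover: "{D \<in> Q. a \<in> D} = {insert a B}" "insert B {D \<in> Q. a \<notin> D} = P" "a \<notin> B"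
      if "partition_on A P" "B \<in> P" "Q = ?f (P, B)" for P B Q
      using that(2,3) aP[OF that(1)] by auto
    have inj2: "inj_on ?f ?S"
    proof (rule inj_onI)
      fix s s' assume s: "s \<in> ?S" "s' \<in> ?S" and eq: "?f s = ?f s'"
      obtain P B P' B' where ss: "s = (P, B)" "s' = (P', B')" by (metis surj_pair)
      have P: "partition_on A P" "B \<in> P" "partition_on A P'" "B' \<in> P'"
        using s ss by auto
      have "?f s = ?f (P, B)" "?f s = ?f (P', B')"
        using eq ss by (simp_all only:)
      note r = recover[OF P(1,2) this(1)] and r' = recover[OF P(3,4) this(2)]
      have "insert a B = insert a B'" using r(1) r'(1) by (metis singleton_inject)
      then have BB: "B = B'" using r(3) r'(3) by (simp add: insert_ident)
      then have "P = P'" using r(2) r'(2) by (simp only:)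
      then show "s = s'" using BB ss by simp
    qed
    have disj: "insert {a} ` ?Part A j \<inter> ?f ` ?S = {}"
    proof -
      have False if P: "partition_on A P" and P': "partition_on A P'" "B \<in> P'"
        and eq: "insert {a} P = ?f (P', B)" for P P' B
      proof -
        have "{a} \<in> {D \<in> insert {a} P. a \<in> D}" by blast
        then have "insert a B = {a}" using recover(1)[OF P' eq] by (metis singletonD)
        then have "B = {}" using aP[OF P'] by auto
        then show False using partition_onD3[OF P'(1)] P'(2) by simp
      qed
      then show ?thesis
        unfolding disjoint_iff by (auto simp only: image_iff mem_Sigma_iff mem_Collect_eq)
    qed
    have "card ?S = (\<Sum>P\<in>?Part A (Suc j). card P)"
      using finPart fin by (subst card_SigmaI) auto
    also have "\<dots> = Suc j * card (?Part A (Suc j))"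
      by simp
    finally have cS: "card ?S = Suc j * card (?Part A (Suc j))" .
    have "finite ?S" using finPart fin by (intro finite_SigmaI) auto
    then have "card (?Part (insert a A) (Suc j)) = card (?Part A j) + card ?S"
      unfolding split using finPart[of j]
      by (subst card_Un_disjoint[OF _ _ disj])
        (simp_all only: finite_imageI card_image[OF inj1] card_image[OF inj2])
    then show ?thesis
      using cS insert.IH[of j] insert.IH[of "Suc j"] insert.hyps Suc
      by (simp del: mult_Suc)
  qed
qed

end

theory Submission
  imports Defs
begin

text \<open>The first two equalities only truncate: \<open>Stirling x k\<close> vanishes for \<open>k > x\<close>, so every
  range of block counts that reaches \<open>x\<close> gives the same row sum, the Bell number.

  The recurrence for Bell numbers comes from a refinement by the number of blocks. In a partition
  of \<open>x + 1\<close> points, single out one point and let \<open>k\<close> be the number of points outside its block.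
  These \<open>k\<close> points can be chosen in \<open>x choose k\<close> ways, and the remaining blocks partition them.
  Hence \<open>Stirling (x + 1) (l + 1)\<close> is the sum of \<open>(x choose k) * Stirling k l\<close>
  (lemma \<open>Stirling_Suc_Suc_binomial\<close>). Summing over \<open>l\<close> and exchanging the sums gives the
  recurrence. The refined identity is derived here from the triangular recurrence of
  the Stirling numbers, by induction on \<open>x\<close> with Pascal's rule.\<close>

lemma sum_Stirling_eq_Bell:
  assumes "x \<le> n"
  shows "(\<Sum>k=0..n. Stirling x k) = Bell x"
  unfolding Bell_def using assms by (intro sum.mono_neutral_right) auto

text \<open>Pascal's rule, summed against an arbitrary weight: passing from row \<open>x\<close> to the next row of
  Pascal's triangle amounts to replacing \<open>f k\<close> by \<open>f k + f (k + 1)\<close>.\<close>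

lemma sum_binomial_Suc:
  fixes f :: "nat \<Rightarrow> nat"
  shows "(\<Sum>k=0..Suc x. (Suc x choose k) * f k)
    = (\<Sum>k=0..x. (x choose k) * f k) + (\<Sum>k=0..x. (x choose k) * f (Suc k))"
proof -
  have "(\<Sum>k=0..Suc x. (Suc x choose k) * f k)
      = f 0 + (\<Sum>k=0..x. (x choose Suc k) * f (Suc k)) + (\<Sum>k=0..x. (x choose k) * f (Suc k))"
    by (simp only: sum.atLeast0_atMost_Suc_shift binomial_Suc_Suc)
       (simp add: algebra_simps sum.distrib)
  also have "f 0 + (\<Sum>k=0..x. (x choose Suc k) * f (Suc k)) = (\<Sum>k=0..Suc x. (x choose k) * f k)"
    by (simp only: sum.atLeast0_atMost_Suc_shift) simp
  also have "\<dots> = (\<Sum>k=0..x. (x choose k) * f k)"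
    by simp
  finally show ?thesis .
qed

text \<open>Removing the block of a distinguished point from a partition into \<open>l + 1\<close> blocks leaves a
  partition of the \<open>k\<close> points outside that block into \<open>l\<close> blocks.\<close>

lemma Stirling_Suc_Suc_binomial:
  "Stirling (Suc x) (Suc l) = (\<Sum>k=0..x. (x choose k) * Stirling k l)"
proof (induction x arbitrary: l)
  case 0
  show ?case by (cases l) simp_all
next
  case (Suc x)
  show ?case
  proof (cases l)
    case 0
    have "(\<Sum>k=0..Suc x. (Suc x choose k) * Stirling k 0)
        = Stirling (Suc x) (Suc 0) + (\<Sum>k=0..x. (x choose k) * Stirling (Suc k) 0)"
      by (simp only: sum_binomial_Suc Suc.IH)
    also have "\<dots> = Stirling (Suc (Suc x)) (Suc 0)"
      by (simp only: Stirling_1 Stirling.simps(3)) simp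
    finally show ?thesis using 0 by (simp only:)
  next
    case (Suc m)
    have "(\<Sum>k=0..x. (x choose k) * Stirling (Suc k) (Suc m))
        = Suc m * (\<Sum>k=0..x. (x choose k) * Stirling k (Suc m))
          + (\<Sum>k=0..x. (x choose k) * Stirling k m)"
      by (simp add: sum_distrib_left sum.distrib algebra_simps)
    also have "\<dots> = Suc m * Stirling (Suc x) (Suc l) + Stirling (Suc x) l"
      using Suc.IH Suc by (simp only:)
    finally have "(\<Sum>k=0..Suc x. (Suc x choose k) * Stirling k l)
        = Stirling (Suc x) (Suc l) + (Suc m * Stirling (Suc x) (Suc l) + Stirling (Suc x) l)"
      using Suc by (simp only: sum_binomial_Suc Suc.IH)
    also have "\<dots> = Suc l * Stirling (Suc x) (Suc l) + Stirling (Suc x) l"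
      using Suc by simp
    also have "\<dots> = Stirling (Suc (Suc x)) (Suc l)"
      by (simp only: Stirling.simps)
    finally show ?thesis by (rule sym)
  qed
qed

lemma sum_binomial_Stirling_eq_Bell:
  assumes "x \<le> n"
  shows "(\<Sum>k=0..x. \<Sum>l=0..n. (x choose k) * Stirling k l) = (\<Sum>k=0..x. (x choose k) * Bell k)"
proof (intro sum.cong refl)
  fix k assume "k \<in> {0..x}"
  then have "k \<le> n" using assms by simp
  then show "(\<Sum>l=0..n. (x choose k) * Stirling k l) = (x choose k) * Bell k"
    by (simp add: sum_distrib_left[symmetric] sum_Stirling_eq_Bell)
qed

lemma Bell_Suc: "Bell (Suc x) = (\<Sum>k=0..x. (x choose k) * Bell k)"
proof -
  have "Bell (Suc x) = (\<Sum>l=0..x. Stirling (Suc x) (Suc l))"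
    unfolding Bell_def by (simp only: sum.atLeast0_atMost_Suc_shift) simp
  also have "\<dots> = (\<Sum>l=0..x. \<Sum>k=0..x. (x choose k) * Stirling k l)"
    by (simp only: Stirling_Suc_Suc_binomial)
  also have "\<dots> = (\<Sum>k=0..x. \<Sum>l=0..x. (x choose k) * Stirling k l)"
    by (rule sum.swap)
  also have "\<dots> = (\<Sum>k=0..x. (x choose k) * Bell k)"
    by (rule sum_binomial_Stirling_eq_Bell) simp
  finally show ?thesis .
qed

theorem corollary15p2:
  fixes n x :: nat
  assumes "n \<ge> x"
  shows "(\<Sum>k=0..n. Stirling x k) = Bell x
    \<and> (\<Sum>k=0..x. \<Sum>l=0..n. (x choose k) * Stirling k l) = (\<Sum>k=0..x. (x choose k) * Bell k)
    \<and> (\<Sum>k=0..x. (x choose k) * Bell k) = Bell (x + 1)"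
  using sum_Stirling_eq_Bell[OF assms] sum_binomial_Stirling_eq_Bell[OF assms] Bell_Suc[of x]
  by simp

end
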